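(* For real numbers $x_1,x_2,\dots,x_n$ with $x_1+x_2+\cdots+x_n=0$, we have $$\frac{1}{n!}\sum_{\sigma}\max_{1\le k\le n}\left|\sum_{i=1}^k(-1)^i x_{\sigma(i)}\right|^2\le\left(17+\frac{16}{17}\right)\sum_{i=1}^n x_i^2,$$ where the sum is taken over all permutations $\sigma$ of $\{1,\dots,n\}$.
   Context: The $x_i$ need not be distinct; $n\ge 1$. *)

theory Defs
  imports Complex_Main "HOL-Combinatorics.Permutations"
begin

end

theory Submission
  imports Defs
begin

text \<open>
  The even alternating partial sums are partial sums of the differences
  \<open>x (\<sigma> (2m+2)) - x (\<sigma> (2m+1))\<close>. Composing \<open>\<sigma>\<close> with the transposition of \<open>2m+1\<close> and \<open>2m+2\<close>
  flips the sign of this difference and keeps all earlier ones, so the even sums form a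
  martingale, whose final second moment is at most \<open>2 * (\<Sum>i. (x i)\<^sup>2)\<close>. Doob's inequality, in a
  pathwise form, bounds the second moment of their maximum by \<open>8 * (\<Sum>i. (x i)\<^sup>2)\<close>. Passing to odd
  partial sums costs one further term of the sequence, and \<open>(a + b)\<^sup>2 \<le> 3/2 * a\<^sup>2 + 3 * b\<^sup>2\<close>
  gives the constant 15.
\<close>

definition partial_sum :: "(nat \<Rightarrow> real) \<Rightarrow> nat \<Rightarrow> real" where
  "partial_sum y m = (\<Sum>i<m. y i)"

text \<open>Starting at index 0 keeps the maximum nonnegative and covers the prefix of length 1,
  whose even part is empty.\<close>

definition max_partial_sum :: "(nat \<Rightarrow> real) \<Rightarrow> nat \<Rightarrow> real" where
  "max_partial_sum y m = (MAX j\<in>{..m}. \<bar>partial_sum y j\<bar>)"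

lemma partial_sum_Suc: "partial_sum y (Suc m) = partial_sum y m + y m"
  by (simp add: partial_sum_def)

lemma max_partial_sum_0: "max_partial_sum y 0 = 0"
  by (simp add: max_partial_sum_def partial_sum_def)

lemma max_partial_sum_Suc:
  "max_partial_sum y (Suc m) = max \<bar>partial_sum y (Suc m)\<bar> (max_partial_sum y m)"
  unfolding max_partial_sum_def atMost_Suc by simp

lemma partial_sum_le_max: "j \<le> m \<Longrightarrow> \<bar>partial_sum y j\<bar> \<le> max_partial_sum y m"
  unfolding max_partial_sum_def by (rule Max_ge) auto

lemma max_partial_sum_nonneg: "0 \<le> max_partial_sum y m"
  using partial_sum_le_max[of 0 m y] by (simp add: partial_sum_def)

lemma partial_sum_cong:
  "(\<And>i. i < m \<Longrightarrow> y i = y' i) \<Longrightarrow> partial_sum y m = partial_sum y' m"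
  by (simp add: partial_sum_def)

lemma max_partial_sum_cong:
  assumes "\<And>i. i < m \<Longrightarrow> y i = y' i"
  shows "max_partial_sum y m = max_partial_sum y' m"
  unfolding max_partial_sum_def
  using assms by (intro arg_cong[where f = Max] image_cong arg_cong[where f = abs] partial_sum_cong) auto

text \<open>Telescoping the squares isolates cross terms in which \<open>y j\<close> is multiplied
  by a function of earlier increments; averaging over permutations will kill them.\<close>

lemma partial_sum_square:
  "(partial_sum y m)\<^sup>2 = (\<Sum>j<m. (y j)\<^sup>2) + (\<Sum>j<m. 2 * partial_sum y j * y j)"
proof (induction m)
  case 0
  then show ?case by (simp add: partial_sum_def)
next
  case (Suc m)
  then show ?case by (simp add: partial_sum_Suc power2_sum)
qed

text \<open>The usual \<open>L\<^sup>2\<close> maximal inequality follows by taking expectations: for a martingale the sum on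
  the right vanishes.\<close>
lemma doob_pathwise:
  "(max_partial_sum y m)\<^sup>2 \<le> 4 * (partial_sum y m)\<^sup>2
     - 4 * (\<Sum>j<m. max_partial_sum y j * sgn (partial_sum y j) * y j)"
proof -
  define D where "D m = (\<Sum>j<m. max_partial_sum y j * sgn (partial_sum y j) * y j)" for m
  have step: "(max_partial_sum y m)\<^sup>2 \<le> 2 * max_partial_sum y m * \<bar>partial_sum y m\<bar> - 2 * D m" for m
  proof (induction m)
    case 0
    then show ?case by (simp add: max_partial_sum_0 D_def)
  next
    case (Suc m)
    define M a b s where "M = max_partial_sum y m" and "a = \<bar>partial_sum y m\<bar>"
      and "b = \<bar>partial_sum y (Suc m)\<bar>" and "s = sgn (partial_sum y m) * y m"
    \<comment> \<open>If the partial sum is 0, then \<open>sgn 0 = 0\<close> makes the left side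
      0.\<close>
    have "a + s \<le> b"
      by (auto simp: a_def b_def s_def partial_sum_Suc sgn_real_def)
    then have "M * (a + s) \<le> M * b"
      using max_partial_sum_nonneg by (intro mult_left_mono) (auto simp: M_def)
    moreover have "M\<^sup>2 \<le> 2 * M * a - 2 * D m"
      using Suc by (simp add: M_def a_def)
    \<comment> \<open>Both sides vanish when the maximum stays at \<open>M\<close>; at a new maximum
      \<open>b\<close> this is \<open>(b - M)\<^sup>2 \<ge> 0\<close>.\<close>
    moreover have "(max b M)\<^sup>2 - M\<^sup>2 \<le> 2 * (max b M - M) * b"
      using zero_le_power2[of "b - M"]
      by (auto simp: max_def power2_eq_square algebra_simps)
    ultimately have "(max b M)\<^sup>2 \<le> 2 * max b M * b - 2 * (D m + M * s)"
      by (simp add: algebra_simps)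
    then show ?case
      by (simp add: max_partial_sum_Suc D_def M_def b_def s_def mult.assoc)
  qed
  have "0 \<le> (max_partial_sum y m - 2 * \<bar>partial_sum y m\<bar>)\<^sup>2"
    by simp
  then have "4 * max_partial_sum y m * \<bar>partial_sum y m\<bar>
      \<le> (max_partial_sum y m)\<^sup>2 + 4 * (partial_sum y m)\<^sup>2"
    by (simp add: power2_diff power_mult_distrib)
  then show ?thesis
    using step[of m] unfolding D_def by linarith
qed

text \<open>Right composition with the transposition permutes the index set and negates every
  summand, so the sum equals its own negative.\<close>

lemma sum_permutes_swap_cancel:
  fixes g :: "('a \<Rightarrow> 'a) \<Rightarrow> real" and x :: "'a \<Rightarrow> real"
  assumes "a \<in> S" "b \<in> S"
    and inv: "\<And>\<sigma>. g (\<sigma> \<circ> transpose a b) = g \<sigma>"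
  shows "(\<Sum>\<sigma> | \<sigma> permutes S. g \<sigma> * (x (\<sigma> a) - x (\<sigma> b))) = 0"
proof -
  let ?f = "\<lambda>\<sigma>. g \<sigma> * (x (\<sigma> a) - x (\<sigma> b))"
  have "sum ?f {\<sigma>. \<sigma> permutes S} = (\<Sum>\<sigma> | \<sigma> permutes S. ?f (\<sigma> \<circ> transpose a b))"
    using permutes_swap_id[OF assms(1) assms(2)] by (rule sum_permutations_compose_right)
  also have "\<dots> = - sum ?f {\<sigma>. \<sigma> permutes S}"
    unfolding inv by (simp add: sum_negf[symmetric] algebra_simps)
  finally show ?thesis by simp
qed

lemma alternating_sum_even:
  fixes z :: "nat \<Rightarrow> real"
  shows "(\<Sum>i=1..2*m. (-1)^i * z i) = partial_sum (\<lambda>j. z (2*j+2) - z (2*j+1)) m"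
  by (induction m) (simp_all add: partial_sum_def)

lemma sum_square_differences_le:
  fixes z :: "nat \<Rightarrow> real"
  shows "(\<Sum>j<m. (z (2*j+2) - z (2*j+1))\<^sup>2) \<le> 2 * (\<Sum>i=1..2*m. (z i)\<^sup>2)"
proof (induction m)
  case 0
  then show ?case by simp
next
  case (Suc m)
  have "(z (2*m+2) - z (2*m+1))\<^sup>2 \<le> 2 * (z (2*m+2))\<^sup>2 + 2 * (z (2*m+1))\<^sup>2"
    using zero_le_power2[of "z (2*m+2) + z (2*m+1)"] by (simp add: power2_sum power2_diff)
  then show ?case using Suc by simp
qed

lemma alternating_sum_square_le:
  fixes z :: "nat \<Rightarrow> real"
  assumes "k \<in> {1..n}"
  shows "\<bar>\<Sum>i=1..k. (-1)^i * z i\<bar>\<^sup>2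
    \<le> 3/2 * (max_partial_sum (\<lambda>j. z (2*j+2) - z (2*j+1)) (n div 2))\<^sup>2 + 3 * (\<Sum>i=1..n. (z i)\<^sup>2)"
proof -
  define m where "m = k div 2"
  define y where "y = (\<lambda>j. z (2*j+2) - z (2*j+1))"
  define r where "r = (if even k then 0 else z k)"
  have "(\<Sum>i=1..k. (-1)^i * z i) = partial_sum y m - r"
  proof (cases "even k")
    case True
    then show ?thesis
      using alternating_sum_even[of z m] by (simp add: m_def y_def r_def)
  next
    case False
    then have "k = Suc (2 * m)" by (simp add: m_def)
    then show ?thesis
      using alternating_sum_even[of z m] by (simp add: y_def r_def)
  qed
  \<comment> \<open>The right side exceeds the left by
    \<open>(partial_sum y m + 2 * r)\<^sup>2 / 2\<close>.\<close>
  moreover have "(partial_sum y m - r)\<^sup>2 \<le> 3/2 * (partial_sum y m)\<^sup>2 + 3 * r\<^sup>2"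
    using zero_le_power2[of "partial_sum y m + 2 * r"]
    by (simp add: power2_sum power2_diff power_mult_distrib)
  moreover have "(partial_sum y m)\<^sup>2 \<le> (max_partial_sum y (n div 2))\<^sup>2"
    using partial_sum_le_max[of m "n div 2" y] assms
    by (intro abs_le_square_iff[THEN iffD1]) (auto simp: m_def div_le_mono)
  moreover have "r\<^sup>2 \<le> (\<Sum>i=1..n. (z i)\<^sup>2)"
    using member_le_sum[OF assms, of "\<lambda>i. (z i)\<^sup>2"] sum_nonneg[of "{1..n}" "\<lambda>i. (z i)\<^sup>2"]
    by (auto simp: r_def)
  ultimately show ?thesis
    unfolding y_def[symmetric] by simp
qed

theorem proposition7:
  fixes n :: nat and x :: "nat \<Rightarrow> real"
  assumes "n \<ge> 1"
    and "(\<Sum>i=1..n. x i) = 0"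
  shows "1 / fact n *
      (\<Sum>\<sigma> | \<sigma> permutes {1..n}.
        (MAX k\<in>{1..n}. \<bar>\<Sum>i=1..k. (-1) ^ i * x (\<sigma> i)\<bar>\<^sup>2))
    \<le> (17 + 16 / 17) * (\<Sum>i=1..n. (x i)\<^sup>2)"
proof -
  define Q where "Q = (\<Sum>i=1..n. (x i)\<^sup>2)"
  define y where "y \<sigma> = (\<lambda>j. x (\<sigma> (2*j+2)) - x (\<sigma> (2*j+1)))" for \<sigma> :: "nat \<Rightarrow> nat"
  \<comment> \<open>The factor 3/2 times the 4 of \<open>doob_pathwise\<close> gives 6, and the 2 in
    the cross terms of \<open>partial_sum_square\<close> turns it into 12 for the first
    summand.\<close>
  define g where "g j \<sigma> = 12 * partial_sum (y \<sigma>) j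
    - 6 * (max_partial_sum (y \<sigma>) j * sgn (partial_sum (y \<sigma>) j))" for j \<sigma>
  let ?P = "{\<sigma>. \<sigma> permutes {1..n}}"
  have pathwise: "(MAX k\<in>{1..n}. \<bar>\<Sum>i=1..k. (-1) ^ i * x (\<sigma> i)\<bar>\<^sup>2)
      \<le> 15 * Q + (\<Sum>j<n div 2. g j \<sigma> * y \<sigma> j)"
    if "\<sigma> \<in> ?P" for \<sigma>
  proof (rule Max.boundedI)
    fix u assume "u \<in> (\<lambda>k. \<bar>\<Sum>i=1..k. (-1) ^ i * x (\<sigma> i)\<bar>\<^sup>2) ` {1..n}"
    then obtain k where k: "k \<in> {1..n}" and u: "u = \<bar>\<Sum>i=1..k. (-1) ^ i * x (\<sigma> i)\<bar>\<^sup>2"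
      by blast
    have Q: "(\<Sum>i=1..n. (x (\<sigma> i))\<^sup>2) = Q"
      using that sum.permute[of \<sigma> "{1..n}" "\<lambda>i. (x i)\<^sup>2"] by (simp add: Q_def o_def)
    have "(\<Sum>i=1..2*(n div 2). (x (\<sigma> i))\<^sup>2) \<le> Q"
      unfolding Q[symmetric] by (rule sum_mono2) auto
    then have sq: "(\<Sum>j<n div 2. (y \<sigma> j)\<^sup>2) \<le> 2 * Q"
      using sum_square_differences_le[of "\<lambda>i. x (\<sigma> i)" "n div 2"] by (simp add: y_def)
    have "u \<le> 3/2 * (max_partial_sum (y \<sigma>) (n div 2))\<^sup>2 + 3 * Q"
      using alternating_sum_square_le[OF k, of "\<lambda>i. x (\<sigma> i)"] unfolding u y_def Q .
    moreover have "(\<Sum>j<n div 2. g j \<sigma> * y \<sigma> j)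
        = 6 * (\<Sum>j<n div 2. 2 * partial_sum (y \<sigma>) j * y \<sigma> j)
        - 6 * (\<Sum>j<n div 2. max_partial_sum (y \<sigma>) j * sgn (partial_sum (y \<sigma>) j) * y \<sigma> j)"
      by (simp add: g_def sum_distrib_left sum_subtractf[symmetric] algebra_simps)
    \<comment> \<open>Here 15 = 6 * 2 + 3, where \<open>sq\<close> supplies the 2 and the possible
      odd term the 3.\<close>
    ultimately show "u \<le> 15 * Q + (\<Sum>j<n div 2. g j \<sigma> * y \<sigma> j)"
      using doob_pathwise[of "y \<sigma>" "n div 2"] partial_sum_square[of "y \<sigma>" "n div 2"] sq
      by linarith
  qed (use assms in auto)
  have cancel: "(\<Sum>\<sigma>\<in>?P. g j \<sigma> * y \<sigma> j) = 0" if "j < n div 2" for j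
  proof -
    \<comment> \<open>Earlier increments read only positions up to \<open>2*j\<close>, which the
      swap fixes, and \<open>g j\<close> depends on those increments alone.\<close>
    have "y (\<sigma> \<circ> transpose (2*j+2) (2*j+1)) i = y \<sigma> i" if "i < j" for i \<sigma>
      using that by (simp add: y_def transpose_def)
    then have "g j (\<sigma> \<circ> transpose (2*j+2) (2*j+1)) = g j \<sigma>" for \<sigma>
      unfolding g_def by (metis (no_types, lifting) partial_sum_cong max_partial_sum_cong)
    then show ?thesis
      using that sum_permutes_swap_cancel[of "2*j+2" "{1..n}" "2*j+1" "g j" x]
      by (simp add: y_def)
  qed
  have "(\<Sum>\<sigma>\<in>?P. MAX k\<in>{1..n}. \<bar>\<Sum>i=1..k. (-1) ^ i * x (\<sigma> i)\<bar>\<^sup>2)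
      \<le> (\<Sum>\<sigma>\<in>?P. 15 * Q + (\<Sum>j<n div 2. g j \<sigma> * y \<sigma> j))"
    using pathwise by (rule sum_mono)
  also have "\<dots> = fact n * (15 * Q) + (\<Sum>j<n div 2. \<Sum>\<sigma>\<in>?P. g j \<sigma> * y \<sigma> j)"
    using card_permutations[of "{1..n}" n]
    by (subst sum.swap) (simp add: sum.distrib)
  also have "\<dots> = fact n * (15 * Q)"
    using cancel by simp
  finally have "1 / fact n * (\<Sum>\<sigma>\<in>?P. MAX k\<in>{1..n}. \<bar>\<Sum>i=1..k. (-1) ^ i * x (\<sigma> i)\<bar>\<^sup>2) \<le> 15 * Q"
    by (simp add: field_simps)
  also have "\<dots> \<le> (17 + 16 / 17) * Q"
    by (intro mult_right_mono) (auto simp: Q_def sum_nonneg)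
  finally show ?thesis
    unfolding Q_def .
qed

end
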